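(* Let $0<\alpha<1$ and let $a,b\in\mathbb{C}$ be constants. The fractional differential equation $$(D^\alpha-a)(D^\alpha-b)\,y(t)=0,\qquad t>0,$$ has solution of the form $$y(t)=A\,E_\alpha(at^\alpha)+B\,E_\alpha(bt^\alpha),$$ where $A$ and $B$ are constants; that is, for arbitrary constants $A,B\in\mathbb{C}$ this function $y$ satisfies the equation.
   Context: For $0<\alpha<1$, $D^\alpha$ denotes the Jumarie (modified Riemann-Liouville) fractional derivative with start point $0$: $$D^\alpha f(t)=\frac{1}{\Gamma(1-\alpha)}\frac{d}{dt}\int_0^t (t-\xi)^{-\alpha}\,[f(\xi)-f(0)]\,d\xi .$$ Products of operators denote composition, and $a$, $b$ in $(D^\alpha-a)$, $(D^\alpha-b)$ act by multiplication, so $(D^\alpha-a)(D^\alpha-b)y=D^\alpha(D^\alpha y)-(a+b)D^\alpha y+ab\,y$. When $D^\alpha$ is applied to a function $D^\alpha f$, the value of $D^\alpha f$ at $0$ is its limit as $t\to0^+$. $E_\alpha$ is the one-parameter Mittag-Leffler function $E_\alpha(z)=\sum_{k=0}^{\infty}\frac{z^k}{\Gamma(1+k\alpha)}$. *)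

theory Defs
  imports "HOL-Analysis.Analysis"
begin

definition mittag_leffler :: "real \<Rightarrow> complex \<Rightarrow> complex" where
  "mittag_leffler \<alpha> z = (\<Sum>k. z ^ k / of_real (Gamma (1 + real k * \<alpha>)))"

definition jumarie_kernel :: "real \<Rightarrow> (real \<Rightarrow> complex) \<Rightarrow> real \<Rightarrow> real \<Rightarrow> complex" where
  "jumarie_kernel \<alpha> f t \<xi> = (t - \<xi>) powr (-\<alpha>) *\<^sub>R (f \<xi> - f 0)"

definition jumarie_integral :: "real \<Rightarrow> (real \<Rightarrow> complex) \<Rightarrow> real \<Rightarrow> complex" where
  "jumarie_integral \<alpha> f t = integral {0..t} (jumarie_kernel \<alpha> f t)"

definition jumarie_pos :: "real \<Rightarrow> (real \<Rightarrow> complex) \<Rightarrow> real \<Rightarrow> complex" where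
  "jumarie_pos \<alpha> f t =
     (1 / Gamma (1 - \<alpha>)) *\<^sub>R vector_derivative (jumarie_integral \<alpha> f) (at t)"

text \<open>The value at \<open>0\<close> is the right limit, which is what a second application
  of the operator uses. Values at negative arguments are never used.\<close>

definition jumarie :: "real \<Rightarrow> (real \<Rightarrow> complex) \<Rightarrow> real \<Rightarrow> complex" where
  "jumarie \<alpha> f t =
     (if t = 0 then Lim (at_right 0) (jumarie_pos \<alpha> f) else jumarie_pos \<alpha> f t)"

text \<open>The functions above are total, so that the integral and the derivative
  exist for every \<open>t > 0\<close> has to be said separately.\<close>

definition jumarie_differentiable :: "real \<Rightarrow> (real \<Rightarrow> complex) \<Rightarrow> bool" where
  "jumarie_differentiable \<alpha> f \<longleftrightarrow>
     (\<forall>t>0. jumarie_kernel \<alpha> f t absolutely_integrable_on {0..t} \<and>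
            jumarie_integral \<alpha> f differentiable (at t))"

text \<open>The operator \<open>D\<^sup>\<alpha> - c\<close>.\<close>

definition jumarie_minus :: "real \<Rightarrow> complex \<Rightarrow> (real \<Rightarrow> complex) \<Rightarrow> real \<Rightarrow> complex" where
  "jumarie_minus \<alpha> c f t = jumarie \<alpha> f t - c * f t"

text \<open>\<open>y\<close> satisfies \<open>(D\<^sup>\<alpha> - a) (D\<^sup>\<alpha> - b) y = 0\<close> on \<open>t > 0\<close>, all
  integrals, derivatives and the limit at \<open>0\<close> involved being required to exist.\<close>

definition solves_jumarie_eq ::
    "real \<Rightarrow> complex \<Rightarrow> complex \<Rightarrow> (real \<Rightarrow> complex) \<Rightarrow> bool" where
  "solves_jumarie_eq \<alpha> a b y \<longleftrightarrow>
     jumarie_differentiable \<alpha> y \<and>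
     (\<exists>l. (jumarie \<alpha> y \<longlongrightarrow> l) (at_right 0)) \<and>
     jumarie_differentiable \<alpha> (jumarie_minus \<alpha> b y) \<and>
     (\<forall>t>0. jumarie_minus \<alpha> a (jumarie_minus \<alpha> b y) t = 0)"

end

theory Submission
  imports Defs
begin

text \<open>
  The function \<open>e\<^sub>c(t) = E\<^sub>\<alpha>(c t\<^sup>\<alpha>)\<close> is an eigenfunction: \<open>D\<^sup>\<alpha> e\<^sub>c = c e\<^sub>c\<close>. The two
  factors of the equation therefore act on \<open>A e\<^sub>a + B e\<^sub>b\<close> diagonally: the factor with \<open>b\<close>
  removes the term in \<open>e\<^sub>b\<close> and leaves \<open>A (a - b) e\<^sub>a\<close>, which the factor with \<open>a\<close> removes.

  The eigenvalue equation comes from an identity between integrals. By Euler's Beta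
  integral, for every \<open>k\<close>,
  \<open>\<integral>\<^sub>0\<^sup>t (t - \<xi>)\<^sup>-\<^sup>\<alpha> \<xi>\<^sup>(\<^sup>k\<^sup>+\<^sup>1\<^sup>)\<^sup>\<alpha> / \<Gamma>(1 + (k+1)\<alpha>) d\<xi>
     = \<Gamma>(1-\<alpha>) t\<^sup>1\<^sup>+\<^sup>k\<^sup>\<alpha> / \<Gamma>(2 + k\<alpha>)
     = \<Gamma>(1-\<alpha>) \<integral>\<^sub>0\<^sup>t \<xi>\<^sup>k\<^sup>\<alpha> / \<Gamma>(1 + k\<alpha>) d\<xi>\<close>,
  so the fractional integral of the term of degree \<open>k + 1\<close> in the series of \<open>e\<^sub>c - 1\<close> is
  \<open>\<Gamma>(1-\<alpha>) c\<close> times the ordinary integral of the term of degree \<open>k\<close> in the series of \<open>e\<^sub>c\<close>.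
  Summing over \<open>k\<close>, which dominated convergence permits
  (\<open>has_integral_weighted_power_series\<close>), gives
  \<open>\<integral>\<^sub>0\<^sup>t (t - \<xi>)\<^sup>-\<^sup>\<alpha> (e\<^sub>c(\<xi>) - e\<^sub>c(0)) d\<xi> = \<Gamma>(1-\<alpha>) c \<integral>\<^sub>0\<^sup>t e\<^sub>c(\<xi>) d\<xi>\<close>
  (\<open>jumarie_kernel_frac_exp\<close>). Since \<open>e\<^sub>c\<close> is continuous, the fundamental theorem of calculus
  then differentiates the right-hand side, and no series has to be differentiated term by term.

  The value of \<open>D\<^sup>\<alpha> y\<close> at \<open>0\<close>, a limit from the right, enters the second application of the
  operator. By continuity of \<open>e\<^sub>c\<close> it agrees with the formula for \<open>t > 0\<close>
  (\<open>jumarie_frac_exp_combination\<close>).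
\<close>

section \<open>Convergence of the Mittag-Leffler series\<close>

text \<open>Logarithmic convexity of the Gamma function on the points \<open>x + \<alpha>\<close>, \<open>x + 1\<close>,
  \<open>x + \<alpha> + 1\<close> gives \<open>x \<Gamma>(x) \<le> (x + \<alpha>)\<^sup>1\<^sup>-\<^sup>\<alpha> \<Gamma>(x + \<alpha>)\<close>. The constant \<open>2\<close> is a crude bound
  for \<open>((x + \<alpha>) / x)\<^sup>1\<^sup>-\<^sup>\<alpha>\<close>. The point of the estimate is that
  \<open>\<Gamma>(x + \<alpha>) / \<Gamma>(x)\<close> tends to infinity, which is what the ratio test needs.\<close>

lemma Gamma_shift_ge:
  fixes \<alpha> x :: real
  assumes "0 < \<alpha>" "\<alpha> \<le> 1" "\<alpha> \<le> x"
  shows "x powr \<alpha> * Gamma x \<le> 2 * Gamma (x + \<alpha>)"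
proof -
  have x: "x > 0" using assms by simp
  have pos: "Gamma x > 0" "Gamma (x + \<alpha>) > 0"
    using x assms by (auto intro!: Gamma_real_pos)
  then have ne: "Gamma x \<noteq> 0" "Gamma (x + \<alpha>) \<noteq> 0" "x \<noteq> 0" "x + \<alpha> \<noteq> 0"
    using x assms by linarith+
  have nn: "x \<notin> \<int>\<^sub>\<le>\<^sub>0" "x + \<alpha> \<notin> \<int>\<^sub>\<le>\<^sub>0"
    using x assms by (auto elim!: nonpos_Ints_cases)
  have "(ln \<circ> Gamma) ((1 - (1 - \<alpha>)) *\<^sub>R (x + \<alpha>) + (1 - \<alpha>) *\<^sub>R (x + \<alpha> + 1))
      \<le> (1 - (1 - \<alpha>)) * (ln \<circ> Gamma) (x + \<alpha>) + (1 - \<alpha>) * (ln \<circ> Gamma) (x + \<alpha> + 1)"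
    by (rule convex_onD[OF log_convex_Gamma_real]) (use x assms in auto)
  also have "(1 - (1 - \<alpha>)) *\<^sub>R (x + \<alpha>) + (1 - \<alpha>) *\<^sub>R (x + \<alpha> + 1) = x + 1"
    by (simp add: algebra_simps)
  finally have "ln (Gamma (x + 1)) \<le> \<alpha> * ln (Gamma (x + \<alpha>)) + (1 - \<alpha>) * ln (Gamma (x + \<alpha> + 1))"
    by simp
  also have "ln (Gamma (x + \<alpha> + 1)) = ln (x + \<alpha>) + ln (Gamma (x + \<alpha>))"
    by (simp add: Gamma_plus1[OF nn(2)] ln_mult ne)
  also have "ln (Gamma (x + 1)) = ln x + ln (Gamma x)"
    by (simp add: Gamma_plus1[OF nn(1)] ln_mult ne)
  finally have 1: "ln x + ln (Gamma x) \<le> (1 - \<alpha>) * ln (x + \<alpha>) + ln (Gamma (x + \<alpha>))"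
    by (simp add: algebra_simps)
  have "ln (x + \<alpha>) \<le> ln (2 * x)"
    using x assms by simp
  then have "(1 - \<alpha>) * ln (x + \<alpha>) \<le> (1 - \<alpha>) * (ln 2 + ln x)"
    using x assms by (intro mult_left_mono) (auto simp: ln_mult)
  also have "\<dots> \<le> ln 2 + (1 - \<alpha>) * ln x"
    using assms by (simp add: algebra_simps)
  finally have "\<alpha> * ln x + ln (Gamma x) \<le> ln 2 + ln (Gamma (x + \<alpha>))"
    using 1 by (simp add: algebra_simps)
  then have "exp (\<alpha> * ln x + ln (Gamma x)) \<le> exp (ln 2 + ln (Gamma (x + \<alpha>)))"
    by simp
  then show ?thesis
    using pos x by (simp add: exp_add powr_def)
qed

lemma summable_mittag_leffler:
  fixes \<alpha> :: real and z :: complex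
  assumes "0 < \<alpha>" "\<alpha> \<le> 1"
  shows "summable (\<lambda>k. z ^ k / of_real (Gamma (1 + real k * \<alpha>)))"
proof -
  have "filterlim (\<lambda>k::nat. 1 + real k * \<alpha>) at_top sequentially"
    by (intro filterlim_tendsto_add_at_top[OF tendsto_const]
          filterlim_at_top_mult_tendsto_pos[OF tendsto_const] filterlim_real_sequentially assms)
  \<comment> \<open>From this index on \<open>4 |z| \<le> x\<^sup>\<alpha>\<close> for \<open>x = 1 + k\<alpha>\<close>, so consecutive terms have ratio at
    most \<open>1/2\<close>.\<close>
  from eventually_compose_filterlim[OF eventually_ge_at_top this]
  have "\<forall>\<^sub>F k in sequentially. (4 * (norm z + 1)) powr (1 / \<alpha>) \<le> 1 + real k * \<alpha>" .
  then obtain N where N: "\<And>k. k \<ge> N \<Longrightarrow> (4 * (norm z + 1)) powr (1 / \<alpha>) \<le> 1 + real k * \<alpha>"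
    by (auto simp: eventually_sequentially)
  show ?thesis
  proof (rule summable_ratio_test[of "1/2" N])
    fix k assume k: "k \<ge> N"
    define x where "x = 1 + real k * \<alpha>"
    have x: "x \<ge> 1" using assms by (simp add: x_def)
    have x': "1 + real (Suc k) * \<alpha> = x + \<alpha>" by (simp add: x_def algebra_simps)
    have pos: "Gamma x > 0" "Gamma (x + \<alpha>) > 0"
      using x assms by (auto intro!: Gamma_real_pos)
    have "4 * (norm z + 1) = ((4 * (norm z + 1)) powr (1 / \<alpha>)) powr \<alpha>"
      using assms by (simp add: powr_powr)
    also have "\<dots> \<le> x powr \<alpha>"
      using N[OF k] assms by (intro powr_mono2) (auto simp: x_def)
    finally have "4 * norm z * Gamma x \<le> x powr \<alpha> * Gamma x"
      using pos by (intro mult_right_mono) auto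
    also have "\<dots> \<le> 2 * Gamma (x + \<alpha>)"
      using Gamma_shift_ge[of \<alpha> x] assms x by simp
    finally have "norm z / Gamma (x + \<alpha>) \<le> 1 / 2 / Gamma x"
      using pos by (simp add: field_simps)
    from mult_left_mono[OF this, of "norm z ^ k"]
    show "norm (z ^ Suc k / complex_of_real (Gamma (1 + real (Suc k) * \<alpha>)))
        \<le> 1 / 2 * norm (z ^ k / complex_of_real (Gamma (1 + real k * \<alpha>)))"
      unfolding x' x_def[symmetric] using pos
      by (simp add: norm_divide norm_power norm_mult mult_ac)
  qed simp
qed

section \<open>Weighted integrals of power series\<close>

lemma has_integral_Beta_scaled:
  fixes a b t :: real
  assumes "a > 0" "b > 0" "t > 0"
  shows "((\<lambda>x. x powr (a - 1) * (t - x) powr (b - 1)) has_integral t powr (a + b - 1) * Beta a b) {0..t}"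
proof -
  have im: "(\<lambda>x. x / (1/t)) ` {0..1} = {0..t}"
    using assms by (simp add: mult.commute[of _ t] image_mult_atLeastAtMost)
  have "((\<lambda>x. ((1/t) * x) powr (a - 1) * (1 - (1/t) * x) powr (b - 1))
          has_integral (1 / \<bar>1/t\<bar>) *\<^sub>R Beta a b) {0..t}"
    using has_integral_stretch_real[OF has_integral_Beta_real[OF assms(1,2)], of "1/t"] assms
    unfolding im by simp
  from has_integral_mult_right[OF this, of "t powr (a + b - 2)"]
  have "((\<lambda>x. t powr (a + b - 2) * (((1/t) * x) powr (a - 1) * (1 - (1/t) * x) powr (b - 1)))
          has_integral (t powr (a + b - 1)) * Beta a b) {0..t}"
    using assms by (simp add: powr_diff powr_add field_simps power2_eq_square)
  then show ?thesis
  proof (rule has_integral_eq[rotated])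
    fix x assume x: "x \<in> {0..t}"
    have e1: "(1/t) * x = x / t" and e2: "1 - x / t = (t - x) / t"
      using assms by (auto simp: field_simps)
    have e3: "t powr (a + b - 2) = t powr (a - 1) * t powr (b - 1)"
      by (simp add: powr_add[symmetric] algebra_simps)
    show "t powr (a + b - 2) * (((1/t) * x) powr (a - 1) * (1 - (1/t) * x) powr (b - 1))
        = x powr (a - 1) * (t - x) powr (b - 1)"
      unfolding e1 e2 e3 using assms x by (simp add: powr_divide)
  qed
qed

text \<open>Termwise integration against a nonnegative weight, which may be unbounded. The partial sums
  are dominated by \<open>M w\<close>, where \<open>M = \<Sum>k. |p\<^sub>k| |R|\<^sup>k\<close>. The case \<open>k = 0\<close> of the moment hypothesis
  makes \<open>w\<close> itself integrable.\<close>

lemma has_integral_weighted_power_series: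
  fixes w u :: "real \<Rightarrow> real" and p :: "nat \<Rightarrow> complex" and m :: "nat \<Rightarrow> real"
  assumes w: "\<And>x. x \<in> S \<Longrightarrow> 0 \<le> w x"
    and u: "\<And>x. x \<in> S \<Longrightarrow> \<bar>u x\<bar> \<le> R"
    and m: "\<And>k. ((\<lambda>x. w x * u x ^ k) has_integral m k) S"
    and p: "\<And>z. summable (\<lambda>k. p k * z ^ k)"
  defines "g \<equiv> \<lambda>x. w x *\<^sub>R (\<Sum>k. p k * of_real (u x) ^ k)"
  shows "g absolutely_integrable_on S"
    and "(\<lambda>k. p k * of_real (m k)) sums integral S g"
proof -
  have sn: "summable (\<lambda>k. norm (p k) * \<bar>r\<bar> ^ k)" for r :: real
  proof -
    have "summable (\<lambda>k. norm (p k * of_real r ^ k))"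
      by (rule powser_insidea[OF p[of "of_real (\<bar>r\<bar> + 1)"]]) simp
    then show ?thesis by (simp add: norm_mult norm_power)
  qed
  define M where "M = (\<Sum>k. norm (p k) * \<bar>R\<bar> ^ k)"
  define h where "h = (\<lambda>n x. w x *\<^sub>R (\<Sum>k<n. p k * of_real (u x) ^ k))"
  have hi: "(h n has_integral (\<Sum>k<n. p k * of_real (m k))) S" for n
  proof -
    have "((\<lambda>x. \<Sum>k<n. p k * of_real (w x * u x ^ k)) has_integral (\<Sum>k<n. p k * of_real (m k))) S"
      by (intro has_integral_sum has_integral_mult_right has_integral_of_real m) auto
    also have "(\<lambda>x. \<Sum>k<n. p k * of_real (w x * u x ^ k)) = h n"
      by (auto simp: h_def scaleR_conv_of_real sum_distrib_left mult_ac)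
    finally show ?thesis .
  qed
  have bound: "norm (h n x) \<le> w x * M" if x: "x \<in> S" for n x
  proof -
    have "norm (\<Sum>k<n. p k * of_real (u x) ^ k) \<le> (\<Sum>k<n. norm (p k) * \<bar>R\<bar> ^ k)"
      by (rule sum_norm_le)
         (use u[OF x] in \<open>auto simp: norm_mult norm_power intro!: mult_left_mono power_mono\<close>)
    also have "\<dots> \<le> M"
      unfolding M_def by (rule sum_le_suminf[OF sn]) auto
    finally show ?thesis
      using w[OF x] by (simp add: h_def mult_left_mono)
  qed
  have "w integrable_on S" using m[of 0] by auto
  then have wM: "(\<lambda>x. w x * M) integrable_on S"
    by (rule integrable_on_mult_left)
  have lim: "(\<lambda>n. h n x) \<longlonglongrightarrow> g x" for x
    unfolding h_def g_def by (intro tendsto_scaleR tendsto_const summable_LIMSEQ p)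
  have hint: "h n integrable_on S" for n using hi by blast
  note dom = dominated_convergence[OF hint wM bound lim, simplified]
  show "g absolutely_integrable_on S"
  proof (rule absolutely_integrable_integrable_bound[OF _ dom(1) wM])
    show "norm (g x) \<le> w x * M" if "x \<in> S" for x
      by (rule tendsto_le[OF _ tendsto_const tendsto_norm[OF lim]])
         (use bound[OF that] in auto)
  qed
  show "(\<lambda>k. p k * of_real (m k)) sums integral S g"
    using dom(2) integral_unique[OF hi] by (simp add: sums_def)
qed

section \<open>Fractional exponentials\<close>

text \<open>The counterpart of \<open>exp (c * t)\<close> for the Jumarie derivative: the eigenfunction of
  \<open>D\<^sup>\<alpha>\<close> for the eigenvalue \<open>c\<close>.\<close>

definition frac_exp :: "real \<Rightarrow> complex \<Rightarrow> real \<Rightarrow> complex" where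
  "frac_exp \<alpha> c t = mittag_leffler \<alpha> (c * of_real (t powr \<alpha>))"

lemma frac_exp_0 [simp]: "frac_exp \<alpha> c 0 = 1"
  using powser_zero[of "\<lambda>k. inverse (complex_of_real (Gamma (1 + real k * \<alpha>)))"]
  by (simp add: frac_exp_def mittag_leffler_def field_simps)

context
  fixes \<alpha> :: real
  assumes \<alpha>: "0 < \<alpha>" "\<alpha> < 1"
begin

lemma summable_frac_exp: "summable (\<lambda>k. c ^ k / of_real (Gamma (1 + real k * \<alpha>)) * z ^ k)" for c z :: complex
  using summable_mittag_leffler[of \<alpha> "c * z"] \<alpha> by (simp add: power_mult_distrib)

lemma frac_exp_eq: "frac_exp \<alpha> c t = (\<Sum>k. c ^ k / of_real (Gamma (1 + real k * \<alpha>)) * of_real (t powr \<alpha>) ^ k)"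
  by (simp add: frac_exp_def mittag_leffler_def power_mult_distrib)

lemma continuous_on_frac_exp: "continuous_on {0..} (frac_exp \<alpha> c)"
proof -
  have "isCont (\<lambda>x. \<Sum>k. c ^ k / of_real (Gamma (1 + real k * \<alpha>)) * x ^ k) z" for z :: complex
    by (rule isCont_powser_converges_everywhere[OF summable_frac_exp])
  then have "continuous_on UNIV (\<lambda>x::complex. \<Sum>k. c ^ k / of_real (Gamma (1 + real k * \<alpha>)) * x ^ k)"
    by (simp add: continuous_on_eq_continuous_at)
  moreover have "continuous_on {0..} (\<lambda>t. complex_of_real (t powr \<alpha>))"
    using \<alpha> by (intro continuous_on_of_real continuous_on_powr') (auto intro!: continuous_intros)
  ultimately show ?thesis
    unfolding frac_exp_eq[abs_def] by (rule continuous_on_compose2) auto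
qed

lemma frac_exp_minus_1:
  "frac_exp \<alpha> c t - 1
     = of_real (t powr \<alpha>) * (\<Sum>k. c ^ Suc k / of_real (Gamma (1 + real (Suc k) * \<alpha>)) * of_real (t powr \<alpha>) ^ k)"
  using powser_split_head(2)[OF summable_frac_exp, of c "of_real (t powr \<alpha>)"]
  by (simp add: frac_exp_eq mult.commute)

section \<open>The eigenvalue equation\<close>

text \<open>Both sides are sums of termwise integrals of power series in \<open>u = x\<^sup>\<alpha>\<close>. On the left a factor
  \<open>x\<^sup>\<alpha>\<close> is split off from \<open>e\<^sub>c(x) - 1\<close> and joined to the weight; this shifts the index by one,
  and the moments \<open>m k\<close> against that weight match the moments \<open>n k\<close> against the weight \<open>1\<close>.\<close>

lemma jumarie_kernel_frac_exp:
  assumes "t > 0"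
  shows "jumarie_kernel \<alpha> (frac_exp \<alpha> c) t absolutely_integrable_on {0..t}"
    and "jumarie_integral \<alpha> (frac_exp \<alpha> c) t
           = of_real (Gamma (1 - \<alpha>)) * c * integral {0..t} (frac_exp \<alpha> c)"
proof -
  define p where "p = (\<lambda>k. c ^ k / of_real (Gamma (1 + real k * \<alpha>)))"
  define p' where "p' = (\<lambda>k. p (Suc k))"
  define w where "w = (\<lambda>x. x powr \<alpha> * (t - x) powr (-\<alpha>))"
  define m where "m = (\<lambda>k. t powr (1 + real k * \<alpha>) * Beta (1 + real (Suc k) * \<alpha>) (1 - \<alpha>))"
  define n where "n = (\<lambda>k. t powr (1 + real k * \<alpha>) / (1 + real k * \<alpha>))"
  have sp: "summable (\<lambda>k. p k * z ^ k)" for z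
    unfolding p_def by (rule summable_frac_exp)
  have sp': "summable (\<lambda>k. p' k * z ^ k)" for z
    using powser_split_head(3)[OF sp] unfolding p'_def .
  have u: "\<bar>x powr \<alpha>\<bar> \<le> t powr \<alpha>" if "x \<in> {0..t}" for x
    using that \<alpha> by (auto intro!: powr_mono2)
  have pw: "(x powr \<alpha>) ^ k = x powr (real k * \<alpha>)" if "x > 0" for x k
    using that by (simp add: powr_powr powr_realpow[symmetric] mult.commute)
  have m: "((\<lambda>x. w x * (x powr \<alpha>) ^ k) has_integral m k) {0..t}" for k
  proof -
    have "((\<lambda>x. x powr (1 + real (Suc k) * \<alpha> - 1) * (t - x) powr (1 - \<alpha> - 1)) has_integral
            t powr (1 + real (Suc k) * \<alpha> + (1 - \<alpha>) - 1) * Beta (1 + real (Suc k) * \<alpha>) (1 - \<alpha>)) {0..t}"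
      by (rule has_integral_Beta_scaled) (use \<alpha> assms in \<open>auto intro!: add_pos_nonneg\<close>)
    also have "t powr (1 + real (Suc k) * \<alpha> + (1 - \<alpha>) - 1) * Beta (1 + real (Suc k) * \<alpha>) (1 - \<alpha>) = m k"
      by (simp add: m_def algebra_simps)
    finally show ?thesis
    proof (rule has_integral_spike_finite[of "{0}", rotated 2])
      fix x assume x: "x \<in> {0..t} - {0}"
      then show "w x * (x powr \<alpha>) ^ k = x powr (1 + real (Suc k) * \<alpha> - 1) * (t - x) powr (1 - \<alpha> - 1)"
        using pw[of x k] by (simp add: w_def powr_add algebra_simps)
    qed simp
  qed
  have n: "((\<lambda>x. 1 * (x powr \<alpha>) ^ k) has_integral n k) {0..t}" for k
  proof -
    have "((\<lambda>x. x powr (real k * \<alpha>)) has_integral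
            t powr (real k * \<alpha> + 1) / (real k * \<alpha> + 1)) {0..t}"
      by (rule has_integral_powr_from_0)
         (use \<alpha> assms in \<open>auto intro: less_le_trans[of _ 0]\<close>)
    also have "t powr (real k * \<alpha> + 1) / (real k * \<alpha> + 1) = n k"
      by (simp add: n_def add.commute)
    \<comment> \<open>At \<open>x = 0\<close> and \<open>k = 0\<close> the integrands differ: \<open>(0 powr \<alpha>) ^ 0 = 1\<close>, but
      \<open>0 powr 0 = 0\<close>.\<close>
    finally show ?thesis
      by (rule has_integral_spike_finite[of "{0}", rotated 2]) (auto simp: pw)
  qed
  have ker: "jumarie_kernel \<alpha> (frac_exp \<alpha> c) t = (\<lambda>x. w x *\<^sub>R (\<Sum>k. p' k * of_real (x powr \<alpha>) ^ k))"
    by (auto simp: jumarie_kernel_def frac_exp_minus_1 w_def p'_def p_def scaleR_conv_of_real)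
  note K = has_integral_weighted_power_series[where w = w and u = "\<lambda>x. x powr \<alpha>" and p = p',
      OF _ u m sp', folded ker]
  have w0: "0 \<le> w x" for x by (simp add: w_def)
  show "jumarie_kernel \<alpha> (frac_exp \<alpha> c) t absolutely_integrable_on {0..t}"
    by (rule K(1)) (rule w0)
  have 1: "(\<lambda>k. p' k * of_real (m k)) sums jumarie_integral \<alpha> (frac_exp \<alpha> c) t"
    unfolding jumarie_integral_def by (rule K(2)) (rule w0)
  have ml: "frac_exp \<alpha> c = (\<lambda>x. 1 *\<^sub>R (\<Sum>k. p k * of_real (x powr \<alpha>) ^ k))"
    by (auto simp: frac_exp_eq p_def)
  have 2: "(\<lambda>k. p k * of_real (n k)) sums integral {0..t} (frac_exp \<alpha> c)"
    unfolding ml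
    by (rule has_integral_weighted_power_series(2)[where w = "\<lambda>_. 1" and u = "\<lambda>x. x powr \<alpha>", OF _ u n sp]) simp
  have "p' k * of_real (m k) = of_real (Gamma (1 - \<alpha>)) * c * (p k * of_real (n k))" for k
  proof -
    define x where "x = 1 + real k * \<alpha>"
    have x: "x > 0" using \<alpha> by (auto simp: x_def intro!: add_pos_nonneg)
    then have "x \<notin> \<int>\<^sub>\<le>\<^sub>0" by (auto elim!: nonpos_Ints_cases)
    from Gamma_plus1[OF this] have G: "Gamma (x + 1) = x * Gamma x" .
    have pos: "Gamma x > 0" "Gamma (x + \<alpha>) > 0" using x \<alpha> by (auto intro!: Gamma_real_pos)
    then have ne: "Gamma x \<noteq> 0" "Gamma (x + \<alpha>) \<noteq> 0" by linarith+
    have "1 + real (Suc k) * \<alpha> = x + \<alpha>" by (simp add: x_def algebra_simps)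
    moreover have "Beta (x + \<alpha>) (1 - \<alpha>) = Gamma (x + \<alpha>) * Gamma (1 - \<alpha>) / (x * Gamma x)"
      by (simp add: Beta_def G)
    ultimately show ?thesis
      using ne x unfolding p'_def p_def m_def n_def x_def[symmetric] by (simp add: mult_ac)
  qed
  then have "(\<lambda>k. p' k * of_real (m k)) sums (of_real (Gamma (1 - \<alpha>)) * c * integral {0..t} (frac_exp \<alpha> c))"
    using sums_mult[OF 2] by simp
  with 1 show "jumarie_integral \<alpha> (frac_exp \<alpha> c) t
           = of_real (Gamma (1 - \<alpha>)) * c * integral {0..t} (frac_exp \<alpha> c)"
    by (rule sums_unique2)
qed

lemma has_vector_derivative_jumarie_integral_frac_exp:
  assumes "t > 0"
  shows "(jumarie_integral \<alpha> (frac_exp \<alpha> c) has_vector_derivative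
           of_real (Gamma (1 - \<alpha>)) * c * frac_exp \<alpha> c t) (at t)"
proof -
  have "((\<lambda>u. integral {0..u} (frac_exp \<alpha> c)) has_vector_derivative frac_exp \<alpha> c t) (at t within {0..t+1})"
    using assms
    by (intro integral_has_vector_derivative continuous_on_subset[OF continuous_on_frac_exp]) auto
  then have "((\<lambda>u. integral {0..u} (frac_exp \<alpha> c)) has_vector_derivative frac_exp \<alpha> c t) (at t)"
    using assms by (simp add: at_within_Icc_at)
  then have "((\<lambda>u. of_real (Gamma (1 - \<alpha>)) * c * integral {0..u} (frac_exp \<alpha> c)) has_vector_derivative
           of_real (Gamma (1 - \<alpha>)) * c * frac_exp \<alpha> c t) (at t)"
    by (rule has_vector_derivative_mult_right)
  then show ?thesis
  proof (rule has_vector_derivative_transform_within)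
    fix u assume "dist u t < t"
    then have "u > 0" by (auto simp: dist_real_def)
    then show "of_real (Gamma (1 - \<alpha>)) * c * integral {0..u} (frac_exp \<alpha> c)
        = jumarie_integral \<alpha> (frac_exp \<alpha> c) u"
      by (simp add: jumarie_kernel_frac_exp)
  qed (use assms in auto)
qed

text \<open>On the span of \<open>e\<^sub>a\<close> and \<open>e\<^sub>b\<close> the operator \<open>D\<^sup>\<alpha>\<close> is diagonal, at \<open>t = 0\<close> as well. Only the
  values of \<open>f\<close> on \<open>t \<ge> 0\<close> are prescribed, because the lemma is to be applied to \<open>(D\<^sup>\<alpha> - b) y\<close>,
  of which nothing is known at negative arguments.\<close>

lemma jumarie_frac_exp_combination:
  assumes f: "\<And>x. x \<ge> 0 \<Longrightarrow> f x = A * frac_exp \<alpha> a x + B * frac_exp \<alpha> b x"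
  shows "jumarie_differentiable \<alpha> f"
    and "(jumarie \<alpha> f \<longlongrightarrow> A * a + B * b) (at_right 0)"
    and "t \<ge> 0 \<Longrightarrow> jumarie \<alpha> f t = A * a * frac_exp \<alpha> a t + B * b * frac_exp \<alpha> b t"
proof -
  let ?K = "jumarie_kernel \<alpha>" and ?J = "jumarie_integral \<alpha>" and ?G = "complex_of_real (Gamma (1 - \<alpha>))"
  let ?g = "\<lambda>t. A * a * frac_exp \<alpha> a t + B * b * frac_exp \<alpha> b t"
  have G: "Gamma (1 - \<alpha>) \<noteq> 0"
    using Gamma_real_pos[of "1 - \<alpha>"] \<alpha> by linarith
  have K: "?K f s x = A * ?K (frac_exp \<alpha> a) s x + B * ?K (frac_exp \<alpha> b) s x" if "x \<in> {0..s}" for s x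
    using that f[of x] f[of 0] by (simp add: jumarie_kernel_def scaleR_conv_of_real algebra_simps)
  have abs: "?K f s absolutely_integrable_on {0..s}" if "s > 0" for s
  proof -
    have "(\<lambda>x. A * ?K (frac_exp \<alpha> a) s x + B * ?K (frac_exp \<alpha> b) s x) absolutely_integrable_on {0..s}"
      by (intro set_integral_add set_integrable_mult_right jumarie_kernel_frac_exp that)
    then show ?thesis
      by (rule set_integrable_cong[THEN iffD1, rotated -1]) (auto simp: K)
  qed
  have J: "?J f s = A * ?J (frac_exp \<alpha> a) s + B * ?J (frac_exp \<alpha> b) s" if "s > 0" for s
  proof -
    have int: "?K (frac_exp \<alpha> c) s integrable_on {0..s}" for c
      using jumarie_kernel_frac_exp(1)[OF that] set_lebesgue_integral_eq_integral(1) by blast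
    have "?J f s = integral {0..s} (\<lambda>x. A * ?K (frac_exp \<alpha> a) s x + B * ?K (frac_exp \<alpha> b) s x)"
      unfolding jumarie_integral_def by (rule integral_cong) (rule K)
    then show ?thesis
      by (simp add: jumarie_integral_def integral_add integrable_on_mult_right int)
  qed
  have deriv: "(?J f has_vector_derivative ?G * ?g s) (at s)" if s: "s > 0" for s
  proof -
    have "((\<lambda>s. A * ?J (frac_exp \<alpha> a) s + B * ?J (frac_exp \<alpha> b) s) has_vector_derivative
            A * (?G * a * frac_exp \<alpha> a s) + B * (?G * b * frac_exp \<alpha> b s)) (at s)"
      by (intro has_vector_derivative_add has_vector_derivative_mult_right
            has_vector_derivative_jumarie_integral_frac_exp s)
    also have "A * (?G * a * frac_exp \<alpha> a s) + B * (?G * b * frac_exp \<alpha> b s) = ?G * ?g s"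
      by (simp add: algebra_simps)
    finally show ?thesis
    proof (rule has_vector_derivative_transform_within)
      fix u assume "dist u s < s"
      then have "u > 0" by (auto simp: dist_real_def)
      then show "A * ?J (frac_exp \<alpha> a) u + B * ?J (frac_exp \<alpha> b) u = ?J f u"
        by (simp add: J)
    qed (use s in auto)
  qed
  show "jumarie_differentiable \<alpha> f"
    unfolding jumarie_differentiable_def using abs deriv differentiableI_vector by blast
  have pos: "jumarie_pos \<alpha> f s = ?g s" if "s > 0" for s
    using G by (simp add: jumarie_pos_def vector_derivative_at[OF deriv[OF that]] scaleR_conv_of_real)
  have "((\<lambda>s. ?g s) \<longlongrightarrow> ?g 0) (at 0 within {0..})"
    by (intro tendsto_intros continuous_on_frac_exp[unfolded continuous_on_def, rule_format]) auto
  then have "(?g \<longlongrightarrow> ?g 0) (at_right 0)"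
    by (rule tendsto_within_subset) auto
  moreover have ev: "\<forall>\<^sub>F s in at_right (0::real). s > 0"
    by (simp add: eventually_at_right_less)
  ultimately have lim: "(jumarie_pos \<alpha> f \<longlongrightarrow> ?g 0) (at_right 0)"
    using pos by (auto elim!: Lim_transform_eventually eventually_mono)
  have "\<forall>\<^sub>F s in at_right 0. jumarie_pos \<alpha> f s = jumarie \<alpha> f s"
    using ev by eventually_elim (simp add: jumarie_def)
  from Lim_transform_eventually[OF lim this]
  show "(jumarie \<alpha> f \<longlongrightarrow> A * a + B * b) (at_right 0)"
    by simp
  show "jumarie \<alpha> f t = ?g t" if "t \<ge> 0"
    using that pos[of t] tendsto_Lim[OF _ lim] by (cases "t = 0") (auto simp: jumarie_def)
qed

end

theorem theorem2:
  fixes \<alpha> :: real and a b A B :: complex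
  assumes "0 < \<alpha>" and "\<alpha> < 1"
  shows "solves_jumarie_eq \<alpha> a b
           (\<lambda>t. A * mittag_leffler \<alpha> (a * of_real (t powr \<alpha>))
              + B * mittag_leffler \<alpha> (b * of_real (t powr \<alpha>)))"
proof -
  define y where "y = (\<lambda>t. A * frac_exp \<alpha> a t + B * frac_exp \<alpha> b t)"
  define v where "v = jumarie_minus \<alpha> b y"
  have Dy: "jumarie_differentiable \<alpha> y" "(jumarie \<alpha> y \<longlongrightarrow> A * a + B * b) (at_right 0)"
    "\<And>t. t \<ge> 0 \<Longrightarrow> jumarie \<alpha> y t = A * a * frac_exp \<alpha> a t + B * b * frac_exp \<alpha> b t"
    by (rule jumarie_frac_exp_combination[OF assms, where f = y]; simp add: y_def)+
  \<comment> \<open>Written with a zero coefficient so that \<open>v\<close> is again a combination of the two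
    fractional exponentials.\<close>
  have v: "v t = (A * (a - b)) * frac_exp \<alpha> a t + 0 * frac_exp \<alpha> b t" if "t \<ge> 0" for t
    using Dy(3)[OF that] by (simp add: v_def jumarie_minus_def y_def algebra_simps)
  have "jumarie_minus \<alpha> a v t = 0" if "t > 0" for t
    using jumarie_frac_exp_combination(3)[OF assms v, of t] v[of t] that
    by (simp add: jumarie_minus_def)
  then have "solves_jumarie_eq \<alpha> a b y"
    using Dy jumarie_frac_exp_combination(1)[OF assms v]
    by (auto simp: solves_jumarie_eq_def v_def)
  then show ?thesis
    by (simp add: y_def frac_exp_def)
qed

end
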